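(* For all integers $n,k\ge 1$, $$N_{n,k}(x)=\frac{1}{n!}\sum_{w\in\mathfrak{S}_n}B_w(x)\,E_{\ell_w+k}(x).$$
   Context: $\mathfrak{S}_n$ is the symmetric group on $\{1,\ldots,n\}$; permutations are written in one-line notation $w=w_1\cdots w_n$, and $\operatorname{des}(w)=|\{i:w_i>w_{i+1}\}|$. The Eulerian polynomial is $E_n(x)=\sum_{w\in\mathfrak{S}_n}x^{\operatorname{des}(w)}$. The type B Narayana polynomial is $B_n(x)=\sum_{k=0}^{n-1}\binom{n-1}{k}^2x^k$. For a permutation $w$ with cycle type $(\lambda_1,\ldots,\lambda_\ell)$ (fixed points counted as cycles), $\ell_w=\ell$ is the number of cycles of $w$ and $B_w(x)=B_{\lambda_1}(x)\cdots B_{\lambda_\ell}(x)$. The stack-sorting map $s:\mathfrak{S}_m\to\mathfrak{S}_m$ is defined as follows. Process the entries of $w$ from left to right with an initially empty stack. At each step, if the stack is empty or the next entry of $w$ is smaller than the top entry of the stack, push the next entry onto the stack; otherwise, pop the top entry of the stack to the end of the output. When all entries of $w$ have been pushed, pop the remaining stack entries one by one to the end of the output. The output is $s(w)$. Let $\mathfrak{S}_{n,k}=\{w\in\mathfrak{S}_{n+k}: w_i=i\text{ for all }i>k\}$ and $N_{n,k}(x)=\sum_{w\in s^{-1}(\mathfrak{S}_{n,k})}x^{\operatorname{des}(w)}$. *)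

theory Defs
  imports
    "HOL-Combinatorics.Combinatorics"
    "HOL-Combinatorics.Orbits"
    "HOL-Computational_Algebra.Polynomial"
begin

text \<open>
  A permutation \<open>w = w\<^sub>1 \<dots> w\<^sub>m\<close> of \<open>{1..m}\<close> is a function \<open>w :: nat \<Rightarrow> nat\<close> with
  \<open>w permutes {1..m}\<close>, so that \<open>w\<^sub>i = w i\<close>, and \<open>w\<close> is the identity outside \<open>{1..m}\<close>.
\<close>

definition sym_grp :: "nat \<Rightarrow> (nat \<Rightarrow> nat) set" where
  "sym_grp m = {w. w permutes {1..m}}"

definition des :: "nat \<Rightarrow> (nat \<Rightarrow> nat) \<Rightarrow> nat" where
  "des m w = card {i \<in> {1..<m}. w i > w (i + 1)}"

definition eulerian_poly :: "nat \<Rightarrow> rat poly" where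
  "eulerian_poly n = (\<Sum>w\<in>sym_grp n. monom 1 (des n w))"

text \<open>Only used for \<open>n \<ge> 1\<close>; \<open>n - 1\<close> is truncated subtraction.\<close>

definition narayana_B_poly :: "nat \<Rightarrow> rat poly" where
  "narayana_B_poly n = (\<Sum>k=0..n - 1. monom (of_nat ((n - 1) choose k) ^ 2) k)"

text \<open>
  The cycles of \<open>w\<close> are taken as the distinct orbits of \<open>w\<close> on \<open>{1..n}\<close>; a fixed point
  \<open>i\<close> contributes the orbit \<open>{i}\<close>.
\<close>

definition cycle_type :: "nat \<Rightarrow> (nat \<Rightarrow> nat) \<Rightarrow> nat multiset" where
  "cycle_type n w = image_mset card (mset_set (orbit w ` {1..n}))"

definition num_cycles :: "nat \<Rightarrow> (nat \<Rightarrow> nat) \<Rightarrow> nat" where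
  "num_cycles n w = size (cycle_type n w)"

definition narayana_B_perm :: "nat \<Rightarrow> (nat \<Rightarrow> nat) \<Rightarrow> rat poly" where
  "narayana_B_perm n w = prod_mset (image_mset narayana_B_poly (cycle_type n w))"

text \<open>
  \<open>stack_run st xs\<close> is the part of the output still to be produced when the stack is
  \<open>st\<close> (top entry first) and the remaining input is \<open>xs\<close>.
\<close>

fun stack_run :: "nat list \<Rightarrow> nat list \<Rightarrow> nat list" where
  "stack_run st [] = st"
| "stack_run [] (x # xs) = stack_run [x] xs"
| "stack_run (t # st) (x # xs) =
     (if x < t then stack_run (x # t # st) xs else t # stack_run st (x # xs))"

definition one_line :: "nat \<Rightarrow> (nat \<Rightarrow> nat) \<Rightarrow> nat list" where
  "one_line m w = map w [1..<m + 1]"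

text \<open>The list index is shifted because list positions start at \<open>0\<close>.\<close>

definition stack_sort :: "nat \<Rightarrow> (nat \<Rightarrow> nat) \<Rightarrow> nat \<Rightarrow> nat" where
  "stack_sort m w i =
     (if i \<in> {1..m} then stack_run [] (one_line m w) ! (i - 1) else i)"

definition sym_grp_fix :: "nat \<Rightarrow> nat \<Rightarrow> (nat \<Rightarrow> nat) set" where
  "sym_grp_fix n k = {w \<in> sym_grp (n + k). \<forall>i\<in>{1..n + k}. i > k \<longrightarrow> w i = i}"

definition N_poly :: "nat \<Rightarrow> nat \<Rightarrow> rat poly" where
  "N_poly n k =
     (\<Sum>w\<in>{w \<in> sym_grp (n + k). stack_sort (n + k) w \<in> sym_grp_fix n k}. monom 1 (des (n + k) w))"

end

theory Submission
  imports Defs "HOL-Computational_Algebra.Formal_Power_Series" "HOL-Library.Sublist"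
begin

text \<open>
  Removing the largest letter \<open>m\<close> from \<open>w = L m R\<close>, where \<open>s(w) = s(L) s(R) m\<close>, gives a recurrence
  for \<open>N\<^sub>n\<^sub>,\<^sub>k\<close>. With \<open>E(t) = \<Sum> E\<^sub>k t\<^sup>k / k!\<close> and \<open>Z(y) = \<Sum> N\<^sub>n\<^sub>,\<^sub>0 y\<^sup>n\<^sup>+\<^sup>1\<close> it solves to
  \<open>H = \<Sum> N\<^sub>n\<^sub>,\<^sub>k y\<^sup>n t\<^sup>k / k! = E (1 + (1 - x) Z) / (1 - x E Z)\<close>. From the quadratic equation for \<open>Z\<close>
  and \<open>E' = E (x E + 1 - x)\<close> one gets \<open>\<partial>H/\<partial>y = S \<cdot> \<partial>H/\<partial>t\<close> with \<open>S = (1 - 2 (1 + x) y + (1 - x)\<^sup>2 y\<^sup>2)\<^sup>-\<^sup>1\<^sup>/\<^sup>2\<close>.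
  This square root generates the type B Narayana polynomials, so comparing coefficients gives
  \<open>n N\<^sub>n\<^sub>,\<^sub>k = \<Sum>\<^sub>j B\<^sub>j N\<^sub>n\<^sub>-\<^sub>j\<^sub>,\<^sub>k\<^sub>+\<^sub>1\<close>. The sum over permutations obeys the same recurrence, by
  classifying \<open>w\<close> according to the cycle through a fixed element.
\<close>

section \<open>Type B Narayana polynomials\<close>

lemma narayana_B_poly_Suc_coeff:
  "coeff (narayana_B_poly (Suc m)) k = of_nat (m choose k) ^ 2"
proof -
  have "coeff (narayana_B_poly (Suc m)) k =
      (\<Sum>i\<in>{0..m}. if i = k then of_nat (m choose i) ^ 2 else 0)"
    by (auto simp: narayana_B_poly_def coeff_sum intro!: sum.cong)
  also have "\<dots> = of_nat (m choose k) ^ 2"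
    by (cases "k \<le> m") (auto simp: binomial_eq_0)
  finally show ?thesis .
qed

text \<open>Pascal's rule expresses every binomial here through three neighbours \<open>u\<close>,
  \<open>v\<close>, \<open>w\<close> in row \<open>M\<close>. The difference of the two sides is
  then twice the left side of \<open>key\<close>, a quadratic relation that follows from the
  absorption identity.\<close>

lemma choose_square_recurrence:
  fixes M :: nat
  defines "c \<equiv> \<lambda>m k. of_nat (m choose k) :: rat"
  shows "of_nat (M + 2) * c (M + 2) (k + 2) ^ 2 =
    of_nat (2 * M + 3) * (c (M + 1) (k + 2) ^ 2 + c (M + 1) (k + 1) ^ 2)
    - of_nat (M + 1) * (c M (k + 2) ^ 2 - 2 * c M (k + 1) ^ 2 + c M k ^ 2)"
proof -
  define u v w where "u = c M (k + 2)" and "v = c M (k + 1)" and "w = c M k"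
  have e1: "c (M + 1) (k + 2) = u + v" "c (M + 1) (k + 1) = v + w"
    "c (M + 2) (k + 2) = u + 2 * v + w"
    by (simp_all add: c_def u_def v_def w_def numeral_2_eq_2)
  have absorb: "of_nat (i + 1) * c M (i + 1) = (of_nat M - of_nat i) * c M i" for i
  proof (cases "i \<le> M")
    case True
    have "(i + 1) * (M choose (i + 1)) = (M - i) * (M choose i)"
      using binomial_absorb_comp[of M i] binomial_absorption[of i M] by simp
    then have "of_nat ((i + 1) * (M choose (i + 1))) = (of_nat ((M - i) * (M choose i)) :: rat)"
      by (simp only:)
    then show ?thesis using True by (simp add: c_def of_nat_diff ring_distribs)
  qed (simp add: c_def binomial_eq_0)
  have uv: "(of_nat k + 2) * u = (of_nat M - of_nat k - 1) * v"
    using absorb[of "k + 1"] by (simp add: u_def v_def algebra_simps)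
  have vw: "(of_nat k + 1) * v = (of_nat M - of_nat k) * w"
    using absorb[of k] by (simp add: v_def w_def algebra_simps)
  define a b :: rat where "a = of_nat M" and "b = of_nat k"
  have key: "u * v + v * w - a * v ^ 2 + (a + 2) * u * w = 0"
  proof -
    have nz: "b + 2 \<noteq> 0" "b + 1 \<noteq> 0"
      using of_nat_0_le_iff[of k, where 'a = rat] unfolding b_def by linarith+
    \<comment> \<open>A common scale factor: \<open>u\<close>, \<open>v\<close>, \<open>w\<close>
      become polynomial multiples of \<open>s\<close>, and \<open>key\<close> turns into a
      polynomial identity.\<close>
    define s where "s = w / ((b + 1) * (b + 2))"
    have w: "w = (b + 1) * (b + 2) * s"
      using nz by (simp add: s_def)
    have "(b + 1) * v = (b + 1) * ((a - b) * (b + 2) * s)"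
      using vw by (simp add: w a_def b_def mult_ac)
    then have v: "v = (a - b) * (b + 2) * s"
      using nz by simp
    have "(b + 2) * u = (b + 2) * ((a - b - 1) * (a - b) * s)"
      using uv by (simp add: v a_def b_def mult_ac)
    then have u: "u = (a - b - 1) * (a - b) * s"
      using nz by simp
    show ?thesis
      unfolding u v w by algebra
  qed
  show ?thesis
    unfolding e1 u_def[symmetric] v_def[symmetric] w_def[symmetric]
    using key by (simp add: a_def) algebra
qed

text \<open>With z = (1 + x) / (1 - x), the polynomial B_{m+1}(x) is (1 - x)^m P_m(z) for the
  Legendre polynomial P_m, and this is the Legendre three-term recurrence. The proof compares
  coefficients.\<close>

lemma narayana_B_poly_recurrence:
  "of_nat (m + 2) * narayana_B_poly (m + 3) =
    of_nat (2 * m + 3) * [:1, 1:] * narayana_B_poly (m + 2)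
    - of_nat (m + 1) * [:1, -1:] ^ 2 * narayana_B_poly (m + 1)"
proof (rule poly_eqI)
  fix k :: nat
  have sq: "[:1, -1:] ^ 2 = [:1, -2, 1 :: rat:]"
    by (simp add: power2_eq_square)
  have B: "coeff (narayana_B_poly (m + 3)) i = of_nat (m + 2 choose i) ^ 2"
    "coeff (narayana_B_poly (m + 2)) i = of_nat (m + 1 choose i) ^ 2"
    "coeff (narayana_B_poly (m + 1)) i = of_nat (m choose i) ^ 2" for i
    using narayana_B_poly_Suc_coeff[of "m + 2" i] narayana_B_poly_Suc_coeff[of "m + 1" i]
      narayana_B_poly_Suc_coeff[of m i] by (simp_all add: numeral_3_eq_3)
  have P: "coeff ([:1, 1:] * q) k = coeff q k + (if k = 0 then 0 else coeff q (k - 1))"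
    "coeff ([:1, -2, 1:] * q) k = coeff q k - 2 * (if k = 0 then 0 else coeff q (k - 1))
      + (if k \<le> 1 then 0 else coeff q (k - 2))" for q :: "rat poly"
    by (simp_all add: coeff_pCons numeral_2_eq_2 split: nat.split)
  have N: "coeff (of_nat i * q) k = of_nat i * coeff q k" for i and q :: "rat poly"
    by (simp add: of_nat_poly)
  have R: "of_nat (m + 2) * of_nat (m + 2 choose k) ^ 2 =
     of_nat (2 * m + 3) * (of_nat (m + 1 choose k) ^ 2
       + (if k = 0 then 0 else of_nat (m + 1 choose (k - 1)) ^ 2))
    - of_nat (m + 1) * (of_nat (m choose k) ^ 2
       - 2 * (if k = 0 then 0 else of_nat (m choose (k - 1)) ^ 2)
       + (if k \<le> 1 then 0 else of_nat (m choose (k - 2)) ^ 2) :: rat)"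
  proof -
    \<comment> \<open>\<open>choose_square_recurrence\<close> has its index shifted by 2 to avoid
      truncated subtraction, so the two lowest coefficients are checked directly.\<close>
    consider "k = 0" | "k = 1" | i where "k = i + 2"
      by (metis One_nat_def Suc_eq_plus1 add_2_eq_Suc' not0_implies_Suc)
    then show ?thesis
    proof cases
      case 3
      then show ?thesis
        using choose_square_recurrence[of m i] by simp
    qed (simp_all add: power2_eq_square algebra_simps)
  qed
  show "coeff (of_nat (m + 2) * narayana_B_poly (m + 3)) k =
    coeff (of_nat (2 * m + 3) * [:1, 1:] * narayana_B_poly (m + 2)
    - of_nat (m + 1) * [:1, -1:] ^ 2 * narayana_B_poly (m + 1)) k"
    unfolding coeff_diff mult.assoc N sq P B by (rule R)
qed

text \<open>The recurrence for \<open>p\<close> is a first-order linear differential equation for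
  its generating function \<open>S\<close>, solved by the inverse square root of 1 - 2 (1 + x) y +
  (1 - x)^2 y^2. The quadratic equation for \<open>Z\<close> makes \<open>T\<close> a square root of
  this discriminant, so no root has to be extracted.\<close>

lemma fps_inverse_sqrt_by_recurrence:
  fixes p :: "nat \<Rightarrow> 'a :: {idom, semiring_char_0}" and x :: 'a and Z :: "'a fps"
  defines "c \<equiv> fps_const x"
  assumes p0: "p 0 = 1" and p1: "p 1 = 1 + x"
    and rec: "\<And>m. of_nat (m + 2) * p (m + 2) =
      of_nat (2 * m + 3) * (1 + x) * p (m + 1) - of_nat (m + 1) * (1 - x) ^ 2 * p m"
    and Z0: "fps_nth Z 0 = 0"
    and Z: "Z = fps_X + (1 - c) * fps_X * Z + c * Z ^ 2"
  shows "Abs_fps p * (1 - (1 - c) * fps_X - 2 * c * Z) = 1"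
proof -
  define S where "S = Abs_fps p"
  define T where "T = 1 - (1 - c) * fps_X - 2 * c * Z"
  define a b where "a = fps_const (1 + x)" and "b = fps_const ((1 - x) ^ 2)"
  have ab: "a = 1 + c" "b = (1 - c) ^ 2"
    by (simp_all add: a_def b_def c_def power2_eq_square flip: fps_const_add fps_const_mult fps_const_sub)
  have ode: "fps_deriv S - 2 * a * fps_X * fps_deriv S + b * fps_X ^ 2 * fps_deriv S =
    (a - b * fps_X) * S"
  proof -
    have "fps_deriv S - fps_const (2 * (1 + x)) * (fps_X * fps_deriv S)
        + b * (fps_X * (fps_X * fps_deriv S)) = a * S - b * (fps_X * S)"
    proof (rule fps_ext)
      fix n :: nat
      consider "n = 0" | m where "n = Suc m"
        by (cases n) auto
      then show "fps_nth (fps_deriv S - fps_const (2 * (1 + x)) * (fps_X * fps_deriv S)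
        + b * (fps_X * (fps_X * fps_deriv S))) n = fps_nth (a * S - b * (fps_X * S)) n"
      proof cases
        case 1
        then show ?thesis
          using p0 p1 by (simp add: S_def a_def b_def)
      next
        case 2
        have L: "fps_nth (fps_X * (fps_X * fps_deriv S)) (Suc m) = of_nat m * p m"
          by (cases m) (simp_all add: S_def)
        have R: "(of_nat m + 2) * p (m + 2) - 2 * (1 + x) * ((of_nat m + 1) * p (m + 1))
            + (1 - x) ^ 2 * (of_nat m * p m) = (1 + x) * p (m + 1) - (1 - x) ^ 2 * p m"
          using rec[of m] unfolding of_nat_add of_nat_mult of_nat_numeral of_nat_1 by algebra
        have "fps_nth (fps_deriv S) (Suc m) = (of_nat m + 2) * p (m + 2)"
          "fps_nth (fps_X * fps_deriv S) (Suc m) = (of_nat m + 1) * p (m + 1)"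
          by (simp_all add: S_def numeral_2_eq_2 algebra_simps)
        with L R show ?thesis
          by (cases m) (simp_all add: 2 a_def b_def S_def ac_simps)
      qed
    qed
    moreover have "fps_const (2 * (1 + x)) = 2 * a"
      by (simp add: a_def fps_numeral_fps_const)
    ultimately show ?thesis
      by (simp add: algebra_simps power2_eq_square)
  qed
  have TT: "T * T = 1 - 2 * a * fps_X + b * fps_X ^ 2"
    unfolding T_def ab using Z by algebra
  have "fps_deriv (T * T) = 2 * (b * fps_X - a)"
    unfolding TT by (simp add: a_def b_def algebra_simps power2_eq_square)
  then have dT: "2 * (T * fps_deriv T) = 2 * (b * fps_X - a)"
    by (simp add: algebra_simps)
  then have dT: "T * fps_deriv T = b * fps_X - a"
    by (metis mult_cancel_left zero_neq_numeral)
  \<comment> \<open>After multiplication by \<open>T\<close>, the derivative of \<open>S * T\<close>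
    contains \<open>T\<close> only through \<open>T * T\<close> and \<open>T * fps_deriv T\<close>,
    which are both polynomials; the differential equation makes it vanish.\<close>
  have "T * (fps_deriv (S * T)) = 0"
    using ode dT TT unfolding fps_deriv_mult by algebra
  moreover have T0: "fps_nth T 0 = 1"
    by (simp add: T_def Z0)
  then have "T \<noteq> 0"
    by auto
  ultimately have "fps_deriv (S * T) = 0"
    by simp
  then have "S * T = fps_const (fps_nth (S * T) 0)"
    by (simp only: fps_deriv_eq_0_iff)
  then show ?thesis
    by (simp add: T0 S_def p0 flip: T_def)
qed

section \<open>Stack-sorting of words\<close>

fun list_des :: "'a :: linorder list \<Rightarrow> nat" where
  "list_des (x # y # zs) = (if y < x then 1 else 0) + list_des (y # zs)"
| "list_des _ = 0"

lemma list_des_snoc: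
  "list_des (xs @ [y]) = list_des xs + (if xs \<noteq> [] \<and> y < last xs then 1 else 0)"
  by (induction xs rule: list_des.induct) auto

lemma list_des_append_max:
  assumes "\<forall>y\<in>set xs \<union> set ys. y < m"
  shows "list_des (xs @ m # ys) = list_des xs + (if ys = [] then 0 else 1) + list_des ys"
  using assms
proof (induction xs rule: list_des.induct)
  case ("2_1")
  then show ?case by (cases ys) auto
next
  case ("2_2" v)
  then show ?case by (cases ys) auto
qed auto

lemma list_des_map:
  assumes "strict_mono_on (set xs) f"
  shows "list_des (map f xs) = list_des xs"
  using assms
proof (induction xs rule: list_des.induct)
  case (1 x y zs)
  moreover have "strict_mono_on (set (y # zs)) f"
    using 1(2) by (rule monotone_on_subset) auto
  ultimately show ?case
    using strict_mono_on_less[OF 1(2), of y x] by simp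
qed auto

lemma mset_stack_run: "mset (stack_run st xs) = mset st + mset xs"
  by (induction st xs rule: stack_run.induct) auto

lemma set_stack_run: "set (stack_run st xs) = set st \<union> set xs"
  using mset_stack_run[of st xs] by (metis set_mset_mset set_mset_union)

lemma length_stack_run: "length (stack_run st xs) = length st + length xs"
  using mset_stack_run[of st xs] by (metis size_mset size_union)

text \<open>Only comparisons between letters steer the run. This is what allows letter sets to be
  standardised.\<close>

lemma stack_run_map:
  assumes "strict_mono_on (set st \<union> set xs) f"
  shows "stack_run (map f st) (map f xs) = map f (stack_run st xs)"
  using assms
proof (induction st xs rule: stack_run.induct)
  case (3 t st x xs)
  have "strict_mono_on (set st \<union> set (x # xs)) f"
    using 3(3) by (rule monotone_on_subset) auto
  moreover have "f x < f t \<longleftrightarrow> x < t"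
    using strict_mono_on_less[OF 3(3), of x t] by simp
  ultimately show ?case
    using 3 by (auto simp: insert_commute)
qed auto

text \<open>When \<open>m\<close> arrives, every letter on the stack is smaller and is popped before
  \<open>m\<close> is pushed.\<close>

lemma stack_run_max_pushed:
  assumes "\<forall>y\<in>set st \<union> set xs. y < m"
  shows "stack_run st (xs @ m # ys) = stack_run st xs @ stack_run [m] ys"
  using assms
proof (induction st xs rule: stack_run.induct)
  case (1 st)
  then show ?case by (induction st) auto
qed auto

text \<open>No incoming letter exceeds \<open>m\<close>, so \<open>m\<close> stays at the bottom
  until the input is exhausted.\<close>

lemma stack_run_max_bottom:
  assumes "\<forall>y\<in>set xs. y < m"
  shows "stack_run (st @ [m]) xs = stack_run st xs @ [m]"
  using assms by (induction st xs rule: stack_run.induct) auto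

lemma stack_run_append_max:
  assumes "\<forall>y\<in>set xs \<union> set ys. y < m"
  shows "stack_run [] (xs @ m # ys) = stack_run [] xs @ stack_run [] ys @ [m]"
  using stack_run_max_pushed[of "[]" xs m ys] stack_run_max_bottom[of ys m "[]"] assms by simp

section \<open>Permutations and their one-line words\<close>

lemma des_eq_list_des: "des n w = list_des (one_line n w)"
proof (induction n)
  case 0
  then show ?case by (simp add: des_def one_line_def)
next
  case (Suc n)
  have *: "one_line (Suc n) w = one_line n w @ [w (Suc n)]"
    by (simp add: one_line_def)
  have "{i \<in> {1..<Suc n}. w i > w (i + 1)} =
      {i \<in> {1..<n}. w i > w (i + 1)} \<union> (if n \<ge> 1 \<and> w (Suc n) < w n then {n} else {})"
    by (auto simp: less_Suc_eq)
  then have "des (Suc n) w = des n w + (if n \<ge> 1 \<and> w (Suc n) < w n then 1 else 0)"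
    by (auto simp: des_def)
  moreover have "one_line n w \<noteq> [] \<longleftrightarrow> n \<ge> 1" "n \<ge> 1 \<Longrightarrow> last (one_line n w) = w n"
    by (auto simp: one_line_def last_map)
  ultimately show ?case
    unfolding * list_des_snoc using Suc by auto
qed

lemma bij_betw_one_line: "bij_betw (one_line n) (sym_grp n) (permutations_of_set {1..n})"
proof (rule bij_betw_imageI)
  show "inj_on (one_line n) (sym_grp n)"
  proof (rule inj_onI)
    fix v w assume vw: "v \<in> sym_grp n" "w \<in> sym_grp n" and eq: "one_line n v = one_line n w"
    have "v i = w i" for i
    proof (cases "i \<in> {1..n}")
      case True
      then show ?thesis
        using eq by (auto simp: one_line_def)
    next
      case False
      then show ?thesis
        using vw by (simp add: sym_grp_def permutes_not_in)
    qed
    then show "v = w" by blast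
  qed
  show "one_line n ` sym_grp n = permutations_of_set {1..n}"
  proof (intro equalityI subsetI)
    fix xs assume "xs \<in> one_line n ` sym_grp n"
    then obtain w where w: "w permutes {1..n}" and xs: "xs = one_line n w"
      by (auto simp: sym_grp_def)
    have "set xs = {1..n}"
      using permutes_image[OF w] by (simp add: xs one_line_def atLeastLessThanSuc_atLeastAtMost del: upt_Suc)
    moreover have "distinct xs"
      using permutes_inj_on[OF w] by (simp add: xs one_line_def distinct_map)
    ultimately show "xs \<in> permutations_of_set {1..n}"
      by (rule permutations_of_setI)
  next
    fix xs assume "xs \<in> permutations_of_set {1..n}"
    then have xs: "set xs = {1..n}" "distinct xs"
      by (auto dest: permutations_of_setD)
    then have len: "length xs = n"
      using distinct_card[of xs] by simp
    define w where "w = (\<lambda>i. if i \<in> {1..n} then xs ! (i - 1) else i)"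
    have "bij_betw ((!) xs) {..<n} {1..n}"
      using bij_betw_nth[OF xs(2), of "{..<n}" "{1..n}"] xs len by simp
    moreover have "bij_betw (\<lambda>i. i - 1) {1..n} {..<n}"
      by (rule bij_betw_byWitness[where f' = Suc]) auto
    ultimately have "bij_betw ((!) xs \<circ> (\<lambda>i. i - 1)) {1..n} {1..n}"
      using bij_betw_trans by blast
    moreover have "bij_betw w {1..n} {1..n} \<longleftrightarrow> bij_betw ((!) xs \<circ> (\<lambda>i. i - 1)) {1..n} {1..n}"
      by (rule bij_betw_cong) (simp add: w_def)
    ultimately have "bij_betw w {1..n} {1..n}"
      by simp
    then have "w permutes {1..n}"
      by (rule bij_imp_permutes) (auto simp: w_def)
    moreover have "one_line n w = xs"
      by (rule nth_equalityI) (auto simp: one_line_def len w_def simp del: upt_Suc)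
    ultimately show "xs \<in> one_line n ` sym_grp n"
      by (auto simp: sym_grp_def)
  qed
qed

text \<open>Fixing every \<open>i > k\<close> means that the output word ends in k+1, ..., n+k in
  this order. As a suffix condition it is easy to split when outputs are concatenated.\<close>

lemma stack_sort_fixes_iff:
  assumes "w \<in> sym_grp (n + k)"
  shows "stack_sort (n + k) w \<in> sym_grp_fix n k \<longleftrightarrow>
    suffix [k + 1..<n + k + 1] (stack_run [] (one_line (n + k) w))"
proof -
  define u where "u = stack_run [] (one_line (n + k) w)"
  have "one_line (n + k) w \<in> permutations_of_set {1..n + k}"
    using bij_betw_one_line[of "n + k"] assms by (auto simp: bij_betw_def)
  then have "mset u = mset_set {1..n + k}"
    by (simp add: u_def mset_stack_run permutations_of_set_altdef permutations_of_multiset_def)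
  then have "u \<in> permutations_of_set {1..n + k}"
    by (simp add: permutations_of_set_altdef permutations_of_multiset_def)
  then obtain v where v: "v \<in> sym_grp (n + k)" "u = one_line (n + k) v"
    using bij_betw_one_line[of "n + k"] by (auto simp: bij_betw_def)
  have len: "length u = n + k"
    by (simp add: v one_line_def del: upt_Suc)
  have "stack_sort (n + k) w = v"
  proof
    fix i
    show "stack_sort (n + k) w i = v i"
    proof (cases "i \<in> {1..n + k}")
      case True
      then have "one_line (n + k) v ! (i - 1) = v i"
        by (cases i) (auto simp: one_line_def simp del: upt_Suc)
      then show ?thesis
        using True by (simp add: stack_sort_def flip: u_def v(2))
    next
      case False
      then show ?thesis
        using v(1) by (auto simp: stack_sort_def sym_grp_def permutes_not_in)
    qed
  qed
  moreover have "v \<in> sym_grp_fix n k \<longleftrightarrow> drop k u = [k + 1..<n + k + 1]"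
  proof -
    have "drop k u = map v [k + 1..<n + k + 1]"
      by (simp add: v(2) one_line_def drop_map drop_upt del: upt_Suc)
    then have "drop k u = [k + 1..<n + k + 1] \<longleftrightarrow> (\<forall>i\<in>{k + 1..<n + k + 1}. v i = i)"
      by (simp add: map_eq_conv[of _ _ "\<lambda>x. x", simplified] del: upt_Suc)
    then show ?thesis
      using v(1) by (auto simp: sym_grp_fix_def)
  qed
  moreover have "drop k u = [k + 1..<n + k + 1] \<longleftrightarrow> suffix [k + 1..<n + k + 1] u"
    using len by (metis add_diff_cancel_left' add_diff_cancel_right' diff_add_inverse length_drop
        length_upt suffix_drop suffix_take append_take_drop_id same_append_eq append_eq_append_conv
        diff_cancel2 add.commute)
  ultimately show ?thesis
    by (simp add: u_def)
qed

text \<open>Arbitrary letter sets are needed because any subset of the letters can stand to the left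
  of the maximum. The indicator sits inside the sum so that independent conditions on two words
  multiply.\<close>

definition stack_gf :: "nat set \<Rightarrow> nat set \<Rightarrow> rat poly" where
  "stack_gf X T = (\<Sum>xs\<in>permutations_of_set X.
     if suffix (sorted_list_of_set T) (stack_run [] xs) then monom 1 (list_des xs) else 0)"

text \<open>The standard form, which turns out to be N_{n,k}. For n = 0 the suffix condition is
  empty and the Eulerian polynomial remains.\<close>

definition stack_poly :: "nat \<Rightarrow> nat \<Rightarrow> rat poly" where
  "stack_poly n k = stack_gf {1..n + k} {k + 1..n + k}"

section \<open>Standardisation of letter sets\<close>

lemma suffix_iff_eq_if_length_eq: "length xs = length ys \<Longrightarrow> suffix xs ys \<longleftrightarrow> xs = ys"
  by (auto simp: suffix_def)

lemma suffix_map_inj_iff: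
  assumes "inj_on f (set xs \<union> set ys)"
  shows "suffix (map f xs) (map f ys) \<longleftrightarrow> suffix xs ys"
proof
  assume "suffix (map f xs) (map f ys)"
  then obtain zs us where "ys = zs @ us" "map f us = map f xs"
    by (metis suffix_def append_eq_map_conv)
  moreover have "us = xs"
    using calculation assms by (intro inj_on_map_eq_map[THEN iffD1, of f]) (auto elim: inj_on_subset)
  ultimately show "suffix xs ys"
    by (simp add: suffix_def)
qed (auto simp: suffix_def)

lemma sorted_list_of_set_image:
  assumes "strict_mono_on T f" "finite T"
  shows "sorted_list_of_set (f ` T) = map f (sorted_list_of_set T)"
proof -
  have "sorted_wrt (<) (map f (sorted_list_of_set T))"
    unfolding sorted_wrt_map using assms
    by (intro sorted_wrt_mono_rel[OF _ strict_sorted_list_of_set]) (auto dest: strict_mono_onD)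
  moreover have "card (f ` T) = card T"
    using assms by (intro card_image strict_mono_on_imp_inj_on)
  ultimately show ?thesis
    using assms by (subst sorted_list_of_set_unique[symmetric]) auto
qed

text \<open>Descents, the stack and the suffix test depend only on the relative order of the
  letters.\<close>

lemma stack_gf_image:
  assumes f: "strict_mono_on X f" and "T \<subseteq> X" and "finite X"
  shows "stack_gf (f ` X) (f ` T) = stack_gf X T"
proof -
  have inj: "inj_on f X"
    using f by (rule strict_mono_on_imp_inj_on)
  have "inj_on (map f) (permutations_of_set X)"
    using inj by (intro inj_on_mapI) (auto dest: permutations_of_setD elim!: inj_on_subset)
  note inj_map = this
  have *: "suffix (sorted_list_of_set (f ` T)) (stack_run [] (map f xs))
      \<longleftrightarrow> suffix (sorted_list_of_set T) (stack_run [] xs)"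
    and **: "list_des (map f xs) = list_des xs" if "xs \<in> permutations_of_set X" for xs
  proof -
    have xs: "set xs = X"
      using that by (rule permutations_of_setD)
    have T: "finite T" "strict_mono_on T f"
      using assms by (auto intro: finite_subset monotone_on_subset[OF f])
    have "stack_run [] (map f xs) = map f (stack_run [] xs)"
      using stack_run_map[of "[]" xs f] f by (simp add: xs)
    then show "suffix (sorted_list_of_set (f ` T)) (stack_run [] (map f xs))
      \<longleftrightarrow> suffix (sorted_list_of_set T) (stack_run [] xs)"
      unfolding sorted_list_of_set_image[OF T(2,1)]
      using inj T assms(2) by (simp add: suffix_map_inj_iff set_stack_run xs Un_absorb1)
    show "list_des (map f xs) = list_des xs"
      using f by (intro list_des_map) (simp add: xs)
  qed
  show ?thesis
    unfolding stack_gf_def permutations_of_set_image_inj[OF inj] sum.reindex[OF inj_map] o_def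
    by (intro sum.cong refl) (simp only: * **)
qed

text \<open>Replacing each letter by its rank \<open>f\<close> in \<open>K \<union> T\<close>
  preserves the order. Since \<open>K\<close> lies below \<open>T\<close>, it receives exactly the
  lowest ranks, so only the two cardinalities matter.\<close>

lemma stack_gf_eq_stack_poly:
  assumes fin: "finite K" "finite T" and less: "\<And>a b. a \<in> K \<Longrightarrow> b \<in> T \<Longrightarrow> a < b"
  shows "stack_gf (K \<union> T) T = stack_poly (card T) (card K)"
proof -
  define X where "X = K \<union> T"
  define f where "f = (\<lambda>a. card {b \<in> X. b \<le> a})"
  have finX: "finite X" using fin by (simp add: X_def)
  have disj: "K \<inter> T = {}" using less by blast
  have cX: "card X = card T + card K"
    using fin disj by (simp add: X_def card_Un_disjoint)
  have mono: "strict_mono_on X f"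
  proof (rule strict_mono_onI)
    fix a b assume "a \<in> X" "b \<in> X" "a < b"
    then have "{c \<in> X. c \<le> a} \<subseteq> {c \<in> X. c \<le> b}"
      "b \<in> {c \<in> X. c \<le> b}" "b \<notin> {c \<in> X. c \<le> a}"
      by auto
    then have "{c \<in> X. c \<le> a} \<subset> {c \<in> X. c \<le> b}" by blast
    then show "f a < f b"
      unfolding f_def using finX by (intro psubset_card_mono) auto
  qed
  then have inj: "inj_on f X"
    by (rule strict_mono_on_imp_inj_on)
  have pos: "f a \<ge> 1" if "a \<in> X" for a
  proof -
    have "{b \<in> X. b \<le> a} \<noteq> {}" using that by auto
    then show ?thesis using finX by (simp add: f_def Suc_le_eq card_gt_0_iff)
  qed
  have "f ` X \<subseteq> {1..card X}"
    using pos finX by (auto simp: f_def intro: card_mono)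
  then have fX: "f ` X = {1..card X}"
    using card_image[OF inj] by (intro card_subset_eq) auto
  have "f ` K \<subseteq> {1..card K}"
  proof
    fix c assume "c \<in> f ` K"
    then obtain a where a: "a \<in> K" "c = f a" by blast
    have "{b \<in> X. b \<le> a} \<subseteq> K"
      using a less by (force simp: X_def)
    then have "f a \<le> card K"
      unfolding f_def using fin by (intro card_mono)
    then show "c \<in> {1..card K}"
      using a pos by (auto simp: X_def)
  qed
  moreover have "inj_on f K"
    using inj by (rule inj_on_subset) (simp add: X_def)
  ultimately have fK: "f ` K = {1..card K}"
    using card_image[of f K] by (intro card_subset_eq) auto
  have "T = X - K"
    using disj by (auto simp: X_def)
  then have "f ` T = f ` X - f ` K"
    using inj_on_image_set_diff[OF inj, of X K] by (simp add: X_def)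
  also have "\<dots> = {card K + 1..card T + card K}"
    by (auto simp: fX fK cX)
  finally have fT: "f ` T = {card K + 1..card T + card K}" .
  have "stack_gf X T = stack_gf (f ` X) (f ` T)"
    using mono finX by (intro stack_gf_image[symmetric]) (auto simp: X_def)
  then have "stack_gf X T = stack_poly (card T) (card K)"
    by (simp only: fX fT cX stack_poly_def)
  then show ?thesis
    by (simp only: X_def)
qed

text \<open>A word containing \<open>m\<close> once splits uniquely at \<open>m\<close>;
  \<open>A\<close> collects the letters to its left.\<close>

lemma sum_permutations_of_set_insert:
  assumes "finite X" "m \<notin> X"
  shows "(\<Sum>xs\<in>permutations_of_set (insert m X). f xs) =
    (\<Sum>A\<in>Pow X. \<Sum>L\<in>permutations_of_set A. \<Sum>R\<in>permutations_of_set (X - A). f (L @ m # R))"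
proof -
  define D where "D = (SIGMA A:Pow X. permutations_of_set A \<times> permutations_of_set (X - A))"
  have "bij_betw (\<lambda>(A, L, R). L @ m # R) D (permutations_of_set (insert m X))"
  proof (rule bij_betw_imageI)
    show "inj_on (\<lambda>(A, L, R). L @ m # R) D"
    proof (rule inj_onI, clarsimp)
      fix A L R A' L' R'
      assume D: "(A, L, R) \<in> D" "(A', L', R') \<in> D" and eq: "L @ m # R = L' @ m # R'"
      then have "m \<notin> set L" "m \<notin> set R" "set L = A" "set L' = A'"
        using assms(2) by (auto simp: D_def permutations_of_set_def)
      then show "A = A' \<and> L = L' \<and> R = R'"
        using eq by (auto simp: append_Cons_eq_iff)
    qed
    show "(\<lambda>(A, L, R). L @ m # R) ` D = permutations_of_set (insert m X)"
    proof (intro equalityI subsetI)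
      fix xs assume "xs \<in> (\<lambda>(A, L, R). L @ m # R) ` D"
      then show "xs \<in> permutations_of_set (insert m X)"
        using assms(2) by (auto simp: D_def permutations_of_set_def)
    next
      fix xs assume xs: "xs \<in> permutations_of_set (insert m X)"
      then have "m \<in> set xs"
        by (simp add: permutations_of_set_def)
      then obtain L R where LR: "xs = L @ m # R"
        by (meson split_list)
      then have "(set L, L, R) \<in> D"
        using xs assms(2) by (auto simp: D_def permutations_of_set_def)
      then show "xs \<in> (\<lambda>(A, L, R). L @ m # R) ` D"
        using LR by force
    qed
  qed
  then have "(\<Sum>xs\<in>permutations_of_set (insert m X). f xs) =
      (\<Sum>z\<in>D. f ((\<lambda>(A, L, R). L @ m # R) z))"
    by (rule sum.reindex_bij_betw[symmetric])
  also have "\<dots> = (\<Sum>A\<in>Pow X. \<Sum>z\<in>permutations_of_set A \<times> permutations_of_set (X - A).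
      f (fst z @ m # snd z))"
    unfolding D_def using assms(1) by (subst sum.Sigma) (auto simp: case_prod_beta)
  finally show ?thesis
    by (simp add: sum.cartesian_product case_prod_beta)
qed

lemma sum_Pow_card:
  fixes h :: "nat \<Rightarrow> 'a :: comm_ring_1"
  assumes "finite X"
  shows "(\<Sum>A\<in>Pow X. h (card A)) = (\<Sum>j\<le>card X. of_nat (card X choose j) * h j)"
proof -
  have "(\<Sum>A\<in>Pow X. h (card A)) = (\<Sum>j\<le>card X. \<Sum>A\<in>{A \<in> Pow X. card A = j}. h (card A))"
    using assms by (intro sum.group[symmetric]) (auto intro: card_mono)
  also have "\<dots> = (\<Sum>j\<le>card X. of_nat (card X choose j) * h j)"
    using assms n_subsets[of X] by (intro sum.cong refl) simp
  finally show ?thesis .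
qed

text \<open>The two sums: either all the \<open>n\<close> largest letters below the maximum stand to its right, or
  the letters to its right are exactly the \<open>r < n\<close> largest ones.\<close>

lemma stack_poly_Suc:
  fixes n k :: nat
  defines "e \<equiv> \<lambda>j :: nat. if j = 0 then 1 else monom 1 1 :: rat poly"
  shows "stack_poly (Suc n) k =
    (\<Sum>j\<le>k. of_nat (k choose j) * (stack_poly 0 j * (e (n + (k - j)) * stack_poly n (k - j))))
    + (\<Sum>r<n. e r * stack_poly r 0 * stack_poly (n - r) k)"
proof -
  define X where "X = {1..n + k}"
  define m where "m = n + k + 1"
  \<comment> \<open>The maximum \<open>m\<close> ends the output automatically, so the remaining
    condition concerns s(L) s(R) alone. The weight \<open>e\<close> records the descent that
    \<open>m\<close> makes when something follows it.\<close>
  define P where "P = (\<lambda>L R. suffix [k + 1..<n + k + 1] (stack_run [] L @ stack_run [] R))"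
  define g where "g = (\<lambda>A. \<Sum>L\<in>permutations_of_set A. \<Sum>R\<in>permutations_of_set (X - A).
    if P L R then e (length R) * monom 1 (list_des L) * monom 1 (list_des R) else 0)"
  have X: "finite X" "m \<notin> X" "{1..Suc n + k} = insert m X"
    by (auto simp: X_def m_def)
  have slT: "sorted_list_of_set {a + 1..b} = [a + 1..<b + 1]" for a b
    by (metis Suc_eq_plus1 atLeastLessThanSuc_atLeastAtMost sorted_list_of_set_range)
  have step: "stack_poly (Suc n) k = (\<Sum>A\<in>Pow X. g A)"
    unfolding stack_poly_def stack_gf_def X(3) sum_permutations_of_set_insert[OF X(1,2)] g_def
  proof (intro sum.cong refl)
    fix A L R
    assume A: "A \<in> Pow X" and L: "L \<in> permutations_of_set A"
      and R: "R \<in> permutations_of_set (X - A)"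
    have less: "\<forall>y\<in>set L \<union> set R. y < m"
      using A permutations_of_setD(1)[OF L] permutations_of_setD(1)[OF R] by (auto simp: X_def m_def)
    have "sorted_list_of_set {k + 1..Suc n + k} = [k + 1..<n + k + 1] @ [m]"
      unfolding slT by (simp add: m_def)
    then have "suffix (sorted_list_of_set {k + 1..Suc n + k}) (stack_run [] (L @ m # R)) \<longleftrightarrow> P L R"
      unfolding P_def stack_run_append_max[OF less] append.assoc[symmetric] by (simp del: append_assoc)
    moreover have "monom 1 (list_des (L @ m # R)) =
        e (length R) * monom 1 (list_des L) * monom 1 (list_des R)"
      unfolding list_des_append_max[OF less] e_def by (simp add: mult_monom ac_simps)
    ultimately show "(if suffix (sorted_list_of_set {k + 1..Suc n + k}) (stack_run [] (L @ m # R))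
      then monom 1 (list_des (L @ m # R)) else 0) =
      (if P L R then e (length R) * monom 1 (list_des L) * monom 1 (list_des R) else 0)"
      by simp
  qed
  \<comment> \<open>If the condition separates into one on \<open>L\<close> and one on
    \<open>R\<close>, the double sum factors.\<close>
  have prod: "g A = e (card (X - A)) * stack_gf A T * stack_gf (X - A) U"
    if "\<And>L R. L \<in> permutations_of_set A \<Longrightarrow> R \<in> permutations_of_set (X - A) \<Longrightarrow> P L R \<longleftrightarrow>
      suffix (sorted_list_of_set T) (stack_run [] L) \<and> suffix (sorted_list_of_set U) (stack_run [] R)"
    for A T U
  proof -
    have "g A = (\<Sum>L\<in>permutations_of_set A. \<Sum>R\<in>permutations_of_set (X - A).
      e (card (X - A)) * ((if suffix (sorted_list_of_set T) (stack_run [] L) then monom 1 (list_des L) else 0) *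
      (if suffix (sorted_list_of_set U) (stack_run [] R) then monom 1 (list_des R) else 0)))"
      unfolding g_def
      by (intro sum.cong refl) (simp add: that length_finite_permutations_of_set)
    then show ?thesis
      unfolding stack_gf_def mult.assoc sum_product by (simp add: sum_distrib_left)
  qed
  have len: "length (stack_run [] R) = card (X - A)" and set: "set (stack_run [] R) = X - A"
    if "R \<in> permutations_of_set (X - A)" for R A
    using that by (simp_all add: length_stack_run set_stack_run length_finite_permutations_of_set
        permutations_of_setD)
  \<comment> \<open>All \<open>n\<close> large letters lie in \<open>R\<close>, so s(R) has at least
    \<open>n\<close> letters and contains the whole required suffix; \<open>L\<close> is
    unrestricted.\<close>
  have low: "g A = stack_poly 0 (card A) * (e (n + (k - card A)) * stack_poly n (k - card A))"
    if A: "A \<in> Pow {1..k}" for A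
  proof -
    have fin: "finite A" using A finite_subset by blast
    have XA: "X - A = ({1..k} - A) \<union> {k + 1..n + k}"
      using A by (auto simp: X_def)
    have cA: "card ({1..k} - A) = k - card A"
      by (rule trans[OF card_Diff_subset[OF fin]]) (use A in auto)
    have cXA: "card (X - A) = n + (k - card A)"
      unfolding XA by (subst card_Un_disjoint) (use cA in auto)
    have "g A = e (card (X - A)) * stack_gf A {} * stack_gf (X - A) {k + 1..n + k}"
    proof (rule prod)
      fix L R assume "L \<in> permutations_of_set A" and R: "R \<in> permutations_of_set (X - A)"
      have "suffix [k + 1..<n + k + 1] (stack_run [] R)"
        if "[k + 1..<n + k + 1] = us @ stack_run [] R" for us
      proof -
        have "length [k + 1..<n + k + 1] = length (us @ stack_run [] R)"
          using that by (simp only:)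
        then have "us = []"
          by (simp add: len[OF R] cXA del: upt_Suc)
        then show ?thesis
          using that by (simp del: upt_Suc)
      qed
      then show "P L R \<longleftrightarrow> suffix (sorted_list_of_set {}) (stack_run [] L) \<and>
          suffix (sorted_list_of_set {k + 1..n + k}) (stack_run [] R)"
        unfolding P_def slT suffix_append by (auto simp del: upt_Suc)
    qed
    moreover have "stack_gf A {} = stack_poly 0 (card A)"
      using stack_gf_eq_stack_poly[of A "{}"] fin by simp
    moreover have "stack_gf (X - A) {k + 1..n + k} = stack_poly n (k - card A)"
      unfolding XA using stack_gf_eq_stack_poly[of "{1..k} - A" "{k + 1..n + k}"] cA by simp
    ultimately show ?thesis
      by (simp add: cXA)
  qed
  \<comment> \<open>Here \<open>R\<close> consists of the \<open>r\<close> largest letters, so s(R)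
    must be sorted and s(L) must end in the rest of the required suffix. The case
    \<open>r = n\<close> would be \<open>A = {1..k}\<close>, which \<open>low\<close> already
    covers.\<close>
  have high: "g {1..n + k - r} = e r * stack_poly r 0 * stack_poly (n - r) k" if r: "r < n" for r
  proof -
    define A where "A = {1..n + k - r}"
    have A: "A = {1..k} \<union> {k + 1..n - r + k}"
      using r by (auto simp: A_def)
    have XA: "X - A = {n - r + k + 1..n + k}"
      using r by (auto simp: A_def X_def)
    have cXA: "card (X - A) = r"
      using r by (simp add: XA)
    have split: "[k + 1..<n + k + 1] = [k + 1..<n - r + k + 1] @ [n - r + k + 1..<n + k + 1]"
      using r upt_add_eq_append[of "k + 1" "n - r + k + 1" r] by simp
    have "g A = e (card (X - A)) * stack_gf A {k + 1..n - r + k} * stack_gf (X - A) {n - r + k + 1..n + k}"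
    proof (rule prod)
      fix L R assume "L \<in> permutations_of_set A" and R: "R \<in> permutations_of_set (X - A)"
      have "P L R \<longleftrightarrow> suffix [k + 1..<n - r + k + 1] (stack_run [] L) \<and> stack_run [] R = [n - r + k + 1..<n + k + 1]"
        unfolding P_def split suffix_def using r len[OF R]
        by (auto simp: cXA append_eq_append_conv simp flip: append_assoc simp del: upt_Suc append_assoc)
      moreover have "stack_run [] R = [n - r + k + 1..<n + k + 1] \<longleftrightarrow> suffix [n - r + k + 1..<n + k + 1] (stack_run [] R)"
      proof -
        have "length (stack_run [] R) = length [n - r + k + 1..<n + k + 1]"
          using r len[OF R] by (simp add: cXA del: upt_Suc)
        then show ?thesis
          by (metis suffix_iff_eq_if_length_eq)
      qed
      ultimately show "P L R \<longleftrightarrow> suffix (sorted_list_of_set {k + 1..n - r + k}) (stack_run [] L) \<and>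
          suffix (sorted_list_of_set {n - r + k + 1..n + k}) (stack_run [] R)"
        unfolding slT by simp
    qed
    moreover have "stack_gf A {k + 1..n - r + k} = stack_poly (n - r) k"
      unfolding A using stack_gf_eq_stack_poly[of "{1..k}" "{k + 1..n - r + k}"] by simp
    moreover have "stack_gf (X - A) {n - r + k + 1..n + k} = stack_poly r 0"
      unfolding XA using stack_gf_eq_stack_poly[of "{}" "{n - r + k + 1..n + k}"] r by simp
    ultimately have "g A = e r * stack_poly r 0 * stack_poly (n - r) k"
      by (simp only: cXA mult_ac)
    then show ?thesis
      by (simp only: A_def)
  qed
  \<comment> \<open>Either the required suffix fits into s(R), so that \<open>A\<close> has no large
    letter, or s(R) is a tail of it, so that \<open>X - A\<close> consists of the largest letters.
    Any other \<open>A\<close> admits no valid pair.\<close>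
  have rest: "g A = 0" if A: "A \<in> Pow X" "A \<notin> Pow {1..k} \<union> (\<lambda>r. {1..n + k - r}) ` {..<n}" for A
  proof -
    have "\<not> P L R" if "L \<in> permutations_of_set A" and R: "R \<in> permutations_of_set (X - A)" for L R
    proof
      assume "P L R"
      then consider "suffix [k + 1..<n + k + 1] (stack_run [] R)"
        | us where "[k + 1..<n + k + 1] = us @ stack_run [] R"
        unfolding P_def suffix_append by blast
      then show False
      proof cases
        case 1
        then have "{k + 1..<n + k + 1} \<subseteq> X - A"
          using set_mono_suffix[OF 1] by (simp add: set[OF R] del: upt_Suc)
        then show False
          using A by (auto simp: X_def subset_iff)
      next
        case 2
        define r where "r = length (stack_run [] R)"
        have "length [k + 1..<n + k + 1] = length us + r"
          unfolding 2 r_def by simp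
        then have r: "r \<le> n" "length us = n - r"
          by (simp_all del: upt_Suc)
        have "stack_run [] R = drop (n - r) [k + 1..<n + k + 1]"
          unfolding 2 using r by simp
        then have "X - A = set (drop (n - r) [k + 1..<n + k + 1])"
          using set[OF R] by simp
        also have "\<dots> = {n - r + k + 1..n + k}"
          by (simp add: atLeastLessThanSuc_atLeastAtMost add.commute del: upt_Suc)
        finally have "X - A = {n - r + k + 1..n + k}" .
        note diff = this
        have "A = X - (X - A)"
          using A(1) by blast
        also have "\<dots> = {1..n + k - r}"
          unfolding diff using r by (auto simp: X_def)
        finally have "A = {1..n + k - r}" .
        then show False
          using A r by (cases "r = n") auto
      qed
    qed
    then show ?thesis
      by (simp add: g_def)
  qed
  have "(\<Sum>A\<in>Pow X. g A) = (\<Sum>A\<in>Pow {1..k} \<union> (\<lambda>r. {1..n + k - r}) ` {..<n}. g A)"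
    by (rule sum.mono_neutral_right) (use rest in \<open>auto simp: X_def\<close>)
  also have "\<dots> = (\<Sum>A\<in>Pow {1..k}. g A) + (\<Sum>A\<in>(\<lambda>r. {1..n + k - r}) ` {..<n}. g A)"
    by (rule sum.union_disjoint) auto
  also have "(\<Sum>A\<in>(\<lambda>r. {1..n + k - r}) ` {..<n}. g A) = (\<Sum>r<n. g {1..n + k - r})"
    by (subst sum.reindex) (auto intro!: inj_onI)
  also have "\<dots> = (\<Sum>r<n. e r * stack_poly r 0 * stack_poly (n - r) k)"
    by (intro sum.cong refl high) simp
  also have "(\<Sum>A\<in>Pow {1..k}. g A) = (\<Sum>A\<in>Pow {1..k}.
      stack_poly 0 (card A) * (e (n + (k - card A)) * stack_poly n (k - card A)))"
    by (intro sum.cong refl low)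
  also have "\<dots> = (\<Sum>j\<le>k. of_nat (k choose j) *
      (stack_poly 0 j * (e (n + (k - j)) * stack_poly n (k - j))))"
    using sum_Pow_card[of "{1..k}" "\<lambda>j. stack_poly 0 j * (e (n + (k - j)) * stack_poly n (k - j))"]
    by simp
  finally show ?thesis
    unfolding step .
qed

text \<open>Stack-sorting always outputs the largest letter last, so a required suffix of length one
  imposes nothing.\<close>

lemma stack_poly_1: "stack_poly 1 k = stack_poly 0 (Suc k)"
  unfolding stack_poly_def stack_gf_def
proof (rule sum.cong)
  fix xs assume "xs \<in> permutations_of_set {1..0 + Suc k}"
  then have xs: "set xs = {1..Suc k}" "distinct xs"
    by (auto dest: permutations_of_setD)
  then have "Suc k \<in> set xs"
    by simp
  then obtain L R where LR: "xs = L @ Suc k # R"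
    by (meson split_list)
  have "y < Suc k" if "y \<in> set L \<union> set R" for y
  proof -
    have "y \<in> set xs" "y \<noteq> Suc k"
      using that xs(2) by (auto simp: LR)
    then show ?thesis by (simp add: xs)
  qed
  then have "suffix [Suc k] (stack_run [] xs)"
    unfolding LR suffix_def by (subst stack_run_append_max) auto
  then show "(if suffix (sorted_list_of_set {k + 1..1 + k}) (stack_run [] xs) then monom 1 (list_des xs) else 0) =
    (if suffix (sorted_list_of_set {Suc k + 1..0 + Suc k}) (stack_run [] xs) then monom 1 (list_des xs) else (0 :: rat poly))"
    by simp
qed simp

section \<open>The polynomials of the theorem as sums over words\<close>

lemma eulerian_poly_eq_stack_poly: "eulerian_poly n = stack_poly 0 n"
proof -
  have "eulerian_poly n = (\<Sum>w\<in>sym_grp n. (\<lambda>xs. monom 1 (list_des xs)) (one_line n w))"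
    by (simp add: eulerian_poly_def des_eq_list_des)
  also have "\<dots> = (\<Sum>xs\<in>permutations_of_set {1..n}. monom 1 (list_des xs))"
    by (rule sum.reindex_bij_betw[OF bij_betw_one_line])
  also have "\<dots> = stack_poly 0 n"
    by (simp add: stack_poly_def stack_gf_def)
  finally show ?thesis .
qed

lemma N_poly_eq_stack_poly: "N_poly n k = stack_poly n k"
proof -
  have "finite (sym_grp (n + k))"
    by (simp add: sym_grp_def finite_permutations)
  then have "N_poly n k = (\<Sum>w\<in>sym_grp (n + k).
      if stack_sort (n + k) w \<in> sym_grp_fix n k then monom 1 (des (n + k) w) else 0)"
    unfolding N_poly_def by (rule sum.inter_filter)
  also have "\<dots> = (\<Sum>w\<in>sym_grp (n + k). (\<lambda>xs. if suffix [k + 1..<n + k + 1] (stack_run [] xs)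
      then monom 1 (list_des xs) else 0) (one_line (n + k) w))"
    by (intro sum.cong refl) (simp add: stack_sort_fixes_iff des_eq_list_des del: upt_Suc)
  also have "\<dots> = (\<Sum>xs\<in>permutations_of_set {1..n + k}.
      if suffix [k + 1..<n + k + 1] (stack_run [] xs) then monom 1 (list_des xs) else 0)"
    by (rule sum.reindex_bij_betw[OF bij_betw_one_line])
  also have "\<dots> = stack_poly n k"
    unfolding stack_poly_def stack_gf_def
    by (metis Suc_eq_plus1 atLeastLessThanSuc_atLeastAtMost sorted_list_of_set_range)
  finally show ?thesis .
qed

section \<open>Permutations weighted by cycle type\<close>

text \<open>For \<open>b = narayana_B_poly\<close> and \<open>e = eulerian_poly\<close> this is the
  sum in the theorem, before division by n!. The set \<open>S\<close> is arbitrary because the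
  induction deletes elements.\<close>

definition cycle_sum :: "(nat \<Rightarrow> 'b) \<Rightarrow> (nat \<Rightarrow> 'b) \<Rightarrow> nat \<Rightarrow> 'a set \<Rightarrow> 'b :: comm_ring_1" where
  "cycle_sum b e k S = (\<Sum>p | p permutes S.
     (\<Prod>c\<in>orbit p ` S. b (card c)) * e (card (orbit p ` S) + k))"

text \<open>The cycle through the root \<open>a\<close> is weighted as if it were longer by \<open>j\<close>, so that
  shortening it by one element can be compensated by raising \<open>j\<close>.\<close>

definition rooted_cycle_sum ::
  "(nat \<Rightarrow> 'b) \<Rightarrow> (nat \<Rightarrow> 'b) \<Rightarrow> nat \<Rightarrow> nat \<Rightarrow> 'a set \<Rightarrow> 'a \<Rightarrow> 'b :: comm_ring_1" where
  "rooted_cycle_sum b e j k S a = (\<Sum>p | p permutes S.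
     b (card (orbit p a) + j) * (\<Prod>c\<in>orbit p ` S - {orbit p a}. b (card c)) *
     e (card (orbit p ` S) + k))"

lemma cycle_sum_eq_rooted:
  assumes "finite S" "a \<in> S"
  shows "cycle_sum b e k S = rooted_cycle_sum b e 0 k S a"
  unfolding cycle_sum_def rooted_cycle_sum_def
proof (intro sum.cong refl)
  fix p
  have "(\<Prod>c\<in>orbit p ` S. b (card c)) =
      b (card (orbit p a)) * (\<Prod>c\<in>orbit p ` S - {orbit p a}. b (card c))"
    using assms by (intro prod.remove) auto
  then show "(\<Prod>c\<in>orbit p ` S. b (card c)) * e (card (orbit p ` S) + k) =
      b (card (orbit p a) + 0) * (\<Prod>c\<in>orbit p ` S - {orbit p a}. b (card c)) *
      e (card (orbit p ` S) + k)"
    by simp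
qed

section \<open>Inserting an element into a cycle\<close>

lemma permutation_orbit_eq:
  assumes "permutation f" "x \<in> orbit f y"
  shows "orbit f x = orbit f y"
proof -
  have y: "y \<in> orbit f x"
    by (rule orbit_swap[OF permutation_self_in_orbit[OF assms(1)] assms(2)])
  show ?thesis
    using orbit_trans[OF _ y] orbit_trans[OF _ assms(2)] by blast
qed

text \<open>The permutation \<open>q\<close> inserts \<open>a\<close> immediately before
  \<open>c\<close> in the cycle of \<open>c\<close>: the preimage of \<open>c\<close> now goes to
  \<open>a\<close>, and \<open>a\<close> goes to \<open>c\<close>. All other cycles are
  untouched.\<close>

lemma
  fixes S :: "'a set"
  assumes p: "p permutes S" and fin: "finite S" and a: "a \<notin> S" and c: "c \<in> S"
  defines "q \<equiv> transpose a c \<circ> p"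
  shows orbit_transpose_comp: "orbit q a = insert a (orbit p c)"
    and orbits_transpose_comp:
      "orbit q ` insert a S = insert (insert a (orbit p c)) (orbit p ` S - {orbit p c})"
proof -
  have perm: "permutation p"
    using p fin by (auto simp: permutation_permutes)
  have permq: "permutation q"
    unfolding q_def using perm by (intro permutation_compose permutation_swap_id)
  have qa: "q a = c"
    using p a by (simp add: q_def permutes_not_in)
  have qx: "q x = (if p x = c then a else p x)" if "x \<in> S" for x
    using that a permutes_in_image[OF p, of x] by (auto simp: q_def transpose_def)
  have sub: "orbit p x \<subseteq> S" if "x \<in> S" for x
    using permutes_orbit_subset[OF p that] .
  have selfc: "c \<in> orbit p c"
    using perm by (rule permutation_self_in_orbit)
  show qa_orbit: "orbit q a = insert a (orbit p c)"
  proof (intro equalityI subsetI)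
    fix x assume "x \<in> orbit q a"
    then show "x \<in> insert a (orbit p c)"
    proof induction
      case base
      then show ?case using selfc by (simp add: qa)
    next
      case (step y)
      from step.IH consider "y = a" | "y \<in> orbit p c"
        by blast
      then show ?case
      proof cases
        case 1
        then show ?thesis using selfc by (simp add: qa)
      next
        case 2
        then have "y \<in> S" using sub[OF c] by blast
        then show ?thesis using 2 by (simp add: qx orbit.step)
      qed
    qed
  next
    have c': "c \<in> orbit q a"
      using orbit.base[of q a] by (simp add: qa)
    have next_in: "p y \<in> orbit q a" if "y \<in> S" "y \<in> orbit q a" for y
      using orbit.step[OF that(2)] qx[OF that(1)] c' by (cases "p y = c") auto
    fix x assume "x \<in> insert a (orbit p c)"
    moreover have "x \<in> orbit q a" if "x \<in> orbit p c"
      using that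
    proof induction
      case base
      then show ?case using c c' next_in by blast
    next
      case (step y)
      then show ?case using next_in sub[OF c] by blast
    qed
    ultimately show "x \<in> orbit q a"
      using permutation_self_in_orbit[OF permq] by auto
  qed
  have same: "orbit q x = orbit p x" if x: "x \<in> S" "x \<notin> orbit p c" for x
  proof -
    \<comment> \<open>An orbit that avoids \<open>c\<close> never maps to \<open>c\<close>, hence
      \<open>p\<close> and \<open>q\<close> agree on it.\<close>
    have ne: "p y \<noteq> c" if "y \<in> orbit p x" for y
    proof
      assume "p y = c"
      then have "c \<in> orbit p x"
        using orbit.step[OF that] by simp
      then have "orbit p c = orbit p x"
        using perm by (intro permutation_orbit_eq)
      then show False
        using x(2) permutation_self_in_orbit[OF perm, of x] by simp
    qed
    show ?thesis
    proof (rule orbit_cong0[symmetric, where A = "orbit p x"])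
      show "x \<in> orbit p x"
        using perm by (rule permutation_self_in_orbit)
      show "p \<in> orbit p x \<rightarrow> orbit p x"
        by (auto intro: orbit.step)
      show "p y = q y" if "y \<in> orbit p x" for y
        using sub[OF x(1)] that by (simp add: qx ne subset_eq)
    qed
  qed
  have merged: "orbit q x = insert a (orbit p c)" if "x \<in> orbit p c" for x
    using permutation_orbit_eq[OF permq, of x a] that by (simp add: qa_orbit)
  have iff: "orbit p x = orbit p c \<longleftrightarrow> x \<in> orbit p c" for x
    using permutation_orbit_eq[OF perm, of x c] permutation_self_in_orbit[OF perm, of x] by auto
  show "orbit q ` insert a S = insert (insert a (orbit p c)) (orbit p ` S - {orbit p c})"
  proof (intro equalityI subsetI)
    fix C assume "C \<in> orbit q ` insert a S"
    then consider "C = orbit q a" | x where "x \<in> S" "C = orbit q x"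
      by blast
    then show "C \<in> insert (insert a (orbit p c)) (orbit p ` S - {orbit p c})"
    proof cases
      case 2
      then show ?thesis
        by (cases "x \<in> orbit p c") (simp_all add: same merged iff)
    qed (simp add: qa_orbit)
  next
    fix C assume "C \<in> insert (insert a (orbit p c)) (orbit p ` S - {orbit p c})"
    then consider "C = orbit q a" | x where "x \<in> S" "C = orbit p x" "x \<notin> orbit p c"
      using iff qa_orbit by auto
    then show "C \<in> orbit q ` insert a S"
    proof cases
      case 2
      then have "C = orbit q x" by (simp add: same)
      then show ?thesis using 2 by simp
    qed simp
  qed
qed

text \<open>The permutations are sorted by the image of the root \<open>a\<close>. If
  \<open>a\<close> is fixed, its cycle is removed and counted by raising \<open>k\<close>. Otherwise
  \<open>a\<close> is deleted from the cycle of its image \<open>c\<close>, which becomes the new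
  root, and raising \<open>j\<close> restores the lost length.\<close>

lemma rooted_cycle_sum_insert:
  fixes S :: "'a set" and b e :: "nat \<Rightarrow> 'b :: comm_ring_1"
  assumes fin: "finite S" and a: "a \<notin> S"
  shows "rooted_cycle_sum b e j k (insert a S) a =
    b (Suc j) * cycle_sum b e (Suc k) S + (\<Sum>c\<in>S. rooted_cycle_sum b e (Suc j) k S c)"
proof -
  define F where "F = (\<lambda>p. b (card (orbit p a) + j) *
    (\<Prod>c\<in>orbit p ` insert a S - {orbit p a}. b (card c)) * e (card (orbit p ` insert a S) + k))"
  have sub: "orbit p x \<subseteq> S" if "p permutes S" "x \<in> S" for p x
    using permutes_orbit_subset[OF that] .
  have notin: "orbit p a \<notin> orbit p ` S" "orbit p a = {a}" if p: "p permutes S" for p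
  proof -
    show "orbit p a = {a}"
      using p a by (simp add: orbit_eq_singleton_iff permutes_not_in)
    then show "orbit p a \<notin> orbit p ` S"
      using sub[OF p] a by blast
  qed
  have fixed: "F (transpose a a \<circ> p) = b (Suc j) *
      ((\<Prod>c\<in>orbit p ` S. b (card c)) * e (card (orbit p ` S) + Suc k))" if p: "p permutes S" for p
    using notin[OF p] fin by (simp add: F_def mult.assoc)
  have other: "F (transpose a c \<circ> p) = b (card (orbit p c) + Suc j) *
      (\<Prod>C\<in>orbit p ` S - {orbit p c}. b (card C)) * e (card (orbit p ` S) + k)"
    if p: "p permutes S" and c: "c \<in> S" for p c
  proof -
    have new: "insert a (orbit p c) \<notin> orbit p ` S - {orbit p c}"
      using sub[OF p] a by blast
    have "card (insert a (orbit p c)) = Suc (card (orbit p c))"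
      using sub[OF p c] a fin by (intro card_insert_disjoint) (auto intro: finite_subset)
    moreover have "card (insert (insert a (orbit p c)) (orbit p ` S - {orbit p c})) =
        Suc (card (orbit p ` S - {orbit p c}))"
      using fin new by (intro card_insert_disjoint) simp_all
    moreover have "Suc (card (orbit p ` S - {orbit p c})) = card (orbit p ` S)"
      using fin c by (intro card_Suc_Diff1) simp_all
    ultimately show ?thesis
      unfolding F_def orbits_transpose_comp[OF p fin a c] orbit_transpose_comp[OF p fin a c]
      using new by simp
  qed
  have "rooted_cycle_sum b e j k (insert a S) a = (\<Sum>p | p permutes insert a S. F p)"
    by (simp add: rooted_cycle_sum_def F_def)
  also have "\<dots> = (\<Sum>c\<in>insert a S. \<Sum>p | p permutes S. F (transpose a c \<circ> p))"
    using fin a by (rule sum_over_permutations_insert)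
  also have "\<dots> = (\<Sum>p | p permutes S. F (transpose a a \<circ> p)) +
      (\<Sum>c\<in>S. \<Sum>p | p permutes S. F (transpose a c \<circ> p))"
    using fin a by simp
  also have "(\<Sum>p | p permutes S. F (transpose a a \<circ> p)) = b (Suc j) * cycle_sum b e (Suc k) S"
    unfolding cycle_sum_def sum_distrib_left by (intro sum.cong refl fixed) simp
  also have "(\<Sum>c\<in>S. \<Sum>p | p permutes S. F (transpose a c \<circ> p)) =
      (\<Sum>c\<in>S. rooted_cycle_sum b e (Suc j) k S c)"
    unfolding rooted_cycle_sum_def by (intro sum.cong refl other) simp_all
  finally show ?thesis .
qed

text \<open>Let n be the size of \<open>S\<close>. A fixed element lies in (n-1)!/(n-1-i)! possible
  cycles of length i+1, and the other elements contribute (n-1-i)! times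
  \<open>r (n - Suc i) (Suc k)\<close>. The factorials combine to (n-1)!, which leaves the assumed
  recurrence.\<close>

lemma cycle_sum_eq_fact_mult:
  fixes b e :: "nat \<Rightarrow> 'b :: {comm_ring_1, semiring_char_0}" and r :: "nat \<Rightarrow> nat \<Rightarrow> 'b"
    and S :: "'a set"
  assumes r0: "\<And>k. r 0 k = e k"
    and rec: "\<And>n k. of_nat n * r n k = (\<Sum>i<n. b (Suc i) * r (n - Suc i) (Suc k))"
    and fin: "finite S"
  shows "cycle_sum b e k S = fact (card S) * r (card S) k"
proof -
  \<comment> \<open>Both sums share one induction, for all \<open>j\<close> and \<open>k\<close>,
    since deleting the root leads to rooted sums with larger \<open>j\<close> and to full sums with
    larger \<open>k\<close>.\<close>
  have "cycle_sum b e k S = fact n * r n k \<and>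
      (\<forall>j. \<forall>a\<in>S. rooted_cycle_sum b e j k S a =
        fact (n - 1) * (\<Sum>i<n. b (Suc i + j) * r (n - Suc i) (Suc k)))"
    if "finite S" "card S = n" for n k and S :: "'a set"
    using that
  proof (induction n arbitrary: S k)
    case 0
    then show ?case
      by (simp add: cycle_sum_def r0)
  next
    case (Suc n)
    have rooted: "rooted_cycle_sum b e j k S a =
        fact n * (\<Sum>i<Suc n. b (Suc i + j) * r (Suc n - Suc i) (Suc k))" if "a \<in> S" for j a
    proof -
      define T where "T = S - {a}"
      have T: "finite T" "a \<notin> T" "S = insert a T" "card T = n"
        using Suc.prems that by (auto simp: T_def)
      have "(\<Sum>c\<in>T. rooted_cycle_sum b e (Suc j) k T c) =
          of_nat n * (fact (n - 1) * (\<Sum>i<n. b (Suc i + Suc j) * r (n - Suc i) (Suc k)))"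
        using Suc.IH[OF T(1,4), of k] T(4) by simp
      \<comment> \<open>For \<open>n = 0\<close> the factorials do not match, but both sides
        vanish.\<close>
      also have "\<dots> = fact n * (\<Sum>i<n. b (Suc i + Suc j) * r (n - Suc i) (Suc k))"
        by (cases n) (simp_all add: mult.assoc del: of_nat_Suc)
      finally have "rooted_cycle_sum b e j k S a = b (Suc j) * (fact n * r n (Suc k)) +
          fact n * (\<Sum>i<n. b (Suc i + Suc j) * r (n - Suc i) (Suc k))"
        unfolding T(3) rooted_cycle_sum_insert[OF T(1,2)] using Suc.IH[OF T(1,4), of "Suc k"] by simp
      then show ?thesis
        by (simp add: sum.lessThan_Suc_shift algebra_simps del: sum.lessThan_Suc)
    qed
    obtain a where a: "a \<in> S"
      using Suc.prems by fastforce
    have "cycle_sum b e k S = fact n * (of_nat (Suc n) * r (Suc n) k)"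
      unfolding cycle_sum_eq_rooted[OF Suc.prems(1) a] rooted[OF a] rec[of "Suc n"] by simp
    then show ?case
      using rooted by (simp add: mult_ac)
  qed
  then show ?thesis
    using fin by blast
qed

lemma sum_narayana_B_perm:
  "(\<Sum>w\<in>sym_grp n. narayana_B_perm n w * e (num_cycles n w + k)) =
    cycle_sum narayana_B_poly e k {1..n}"
proof -
  have "narayana_B_perm n w * e (num_cycles n w + k) =
      (\<Prod>c\<in>orbit w ` {1..n}. narayana_B_poly (card c)) * e (card (orbit w ` {1..n}) + k)" for w
  proof (rule arg_cong2[of _ _ _ _ times])
    show "narayana_B_perm n w = (\<Prod>c\<in>orbit w ` {1..n}. narayana_B_poly (card c))"
      by (simp only: narayana_B_perm_def cycle_type_def multiset.map_comp o_def prod_unfold_prod_mset)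
    show "e (num_cycles n w + k) = e (card (orbit w ` {1..n}) + k)"
      by (simp only: num_cycles_def cycle_type_def size_image_mset size_mset_set)
  qed
  then show ?thesis
    unfolding cycle_sum_def sym_grp_def by (simp only: mem_Collect_eq)
qed

section \<open>Generating functions\<close>

definition stack_egf :: "nat \<Rightarrow> rat poly fps" where
  "stack_egf n = Abs_fps (\<lambda>k. smult (1 / fact k) (stack_poly n k))"

text \<open>The series H(y, t): the outer variable y marks \<open>n\<close> and the inner variable t
  marks \<open>k\<close>, exponentially. Thus \<open>fps_deriv\<close> differentiates in y and
  \<open>fps_coeff_deriv\<close> below in t.\<close>

definition stack_series :: "rat poly fps fps" where
  "stack_series = Abs_fps stack_egf"

definition fps_coeff_deriv :: "'a :: comm_ring_1 fps fps \<Rightarrow> 'a fps fps" where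
  "fps_coeff_deriv f = Abs_fps (\<lambda>n. fps_deriv (fps_nth f n))"

lemma fps_coeff_deriv_add: "fps_coeff_deriv (f + g) = fps_coeff_deriv f + fps_coeff_deriv g"
  by (rule fps_ext) (simp add: fps_coeff_deriv_def)

lemma fps_coeff_deriv_diff: "fps_coeff_deriv (f - g) = fps_coeff_deriv f - fps_coeff_deriv g"
  by (rule fps_ext) (simp add: fps_coeff_deriv_def)

lemma fps_coeff_deriv_mult:
  "fps_coeff_deriv (f * g) = fps_coeff_deriv f * g + f * fps_coeff_deriv g"
  by (rule fps_ext)
    (simp add: fps_coeff_deriv_def fps_mult_nth fps_deriv_sum sum.distrib add.commute)

lemma smult_sum_right: "smult c (sum f A) = (\<Sum>i\<in>A. smult c (f i))"
  by (induction A rule: infinite_finite_induct) (auto simp: smult_add_right)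

section \<open>From recurrences to functional equations\<close>

lemma stack_poly_0_0: "stack_poly 0 0 = 1"
  by (simp add: stack_poly_def stack_gf_def)

text \<open>The binomial convolution becomes multiplication by the Eulerian series
  \<open>stack_egf 0\<close>. The descent weight is x unless nothing follows the maximum; in this
  convolution that happens only for the constant term at n = 0, whence the correction 1 - x.\<close>

lemma stack_egf_Suc:
  fixes n :: nat
  defines "x \<equiv> fps_const (monom 1 1)"
  defines "c \<equiv> \<lambda>r. fps_const ((if r = 0 then 1 else monom 1 1) * stack_poly r 0)"
  shows "stack_egf (Suc n) = stack_egf 0 * (x * stack_egf n + (if n = 0 then 1 - x else 0))
    + (\<Sum>r<n. c r * stack_egf (n - r))"
proof (rule fps_ext)
  fix k
  define e where "e = (\<lambda>j :: nat. if j = 0 then 1 else monom 1 1 :: rat poly)"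
  define G where "G = x * stack_egf n + (if n = 0 then 1 - x else 0)"
  have G: "fps_nth G i = smult (1 / fact i) (e (n + i) * stack_poly n i)" for i
    by (cases "n = 0"; cases "i = 0") (simp_all add: G_def x_def e_def stack_egf_def stack_poly_0_0)
  have product: "fps_nth (stack_egf 0) j * fps_nth G (k - j) = smult (1 / fact k)
      (of_nat (k choose j) * (stack_poly 0 j * (e (n + (k - j)) * stack_poly n (k - j))))"
    if "j \<le> k" for j
  proof -
    have "1 / fact k * of_nat (k choose j) = (1 / fact j * (1 / fact (k - j)) :: rat)"
      using that by (simp add: binomial_fact)
    then show ?thesis
      by (simp add: G stack_egf_def of_nat_poly mult_ac)
  qed
  have "fps_nth (stack_egf 0 * G) k = (\<Sum>j\<le>k. smult (1 / fact k)
      (of_nat (k choose j) * (stack_poly 0 j * (e (n + (k - j)) * stack_poly n (k - j)))))"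
    unfolding fps_mult_nth atLeast0AtMost by (intro sum.cong refl product) simp
  moreover have "fps_nth (\<Sum>r<n. c r * stack_egf (n - r)) k =
      (\<Sum>r<n. smult (1 / fact k) (e r * stack_poly r 0 * stack_poly (n - r) k))"
    unfolding fps_sum_nth by (intro sum.cong refl) (simp add: c_def e_def stack_egf_def)
  moreover have "fps_nth (stack_egf (Suc n)) k = smult (1 / fact k) (
      (\<Sum>j\<le>k. of_nat (k choose j) * (stack_poly 0 j * (e (n + (k - j)) * stack_poly n (k - j))))
      + (\<Sum>r<n. e r * stack_poly r 0 * stack_poly (n - r) k))"
    unfolding e_def stack_egf_def fps_nth_Abs_fps by (subst stack_poly_Suc) (rule refl)
  ultimately show "fps_nth (stack_egf (Suc n)) k =
    fps_nth (stack_egf 0 * (x * stack_egf n + (if n = 0 then 1 - x else 0))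
      + (\<Sum>r<n. c r * stack_egf (n - r))) k"
    by (simp only: G_def fps_add_nth smult_add_right smult_sum_right)
qed

lemma fps_deriv_stack_egf:
  "fps_deriv (stack_egf n) = Abs_fps (\<lambda>k. smult (1 / fact k) (stack_poly n (Suc k)))"
proof (rule fps_ext)
  fix k
  have "of_nat (Suc k) * (1 / fact (Suc k)) = (1 / fact k :: rat)"
    by (simp add: field_simps del: of_nat_Suc)
  then show "fps_nth (fps_deriv (stack_egf n)) k =
      fps_nth (Abs_fps (\<lambda>k. smult (1 / fact k) (stack_poly n (Suc k)))) k"
    by (simp add: stack_egf_def of_nat_poly del: of_nat_Suc fact_Suc)
qed

text \<open>For k = 0 the first sum of \<open>stack_poly_Suc\<close> has a single term, namely the
  missing term r = n of the second.\<close>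

lemma stack_poly_0_right_Suc:
  "stack_poly (Suc n) 0 =
    (\<Sum>r\<le>n. (if r = 0 then 1 else monom 1 1) * stack_poly r 0 * stack_poly (n - r) 0)"
proof -
  have "stack_poly (Suc n) 0 = (if n = 0 then 1 else monom 1 1) * stack_poly n 0
      + (\<Sum>r<n. (if r = 0 then 1 else monom 1 1) * stack_poly r 0 * stack_poly (n - r) 0)"
    unfolding stack_poly_Suc by (simp add: stack_poly_0_0)
  then show ?thesis
    by (simp add: lessThan_Suc_atMost[symmetric] stack_poly_0_0 add.commute)
qed

lemma stack_poly_recurrence:
  "of_nat n * stack_poly n k =
    (\<Sum>i<n. narayana_B_poly (Suc i) * stack_poly (n - Suc i) (Suc k))"
proof -
  define x E H where "x = fps_const (fps_const (monom 1 1 :: rat poly))"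
    and "E = fps_const (stack_egf 0)" and "H = stack_series"
  define N C S where "N = Abs_fps (\<lambda>n. fps_const (stack_poly n 0))"
    and "C = Abs_fps (\<lambda>r. fps_const ((if r = 0 then 1 else monom 1 1) * stack_poly r 0))"
    and "S = Abs_fps (\<lambda>m. fps_const (narayana_B_poly (Suc m)))"
  define Z where "Z = fps_X * N"
  have C: "C = (1 - x) + x * N"
    by (rule fps_ext) (simp add: C_def x_def N_def stack_poly_0_0 flip: fps_const_sub)
  \<comment> \<open>The second sum in \<open>stack_egf_Suc\<close> only meets
    \<open>stack_egf (n - r)\<close> with \<open>n - r > 0\<close>, so \<open>H - E\<close> appears
    in place of \<open>H\<close>.\<close>
  have H: "H = E + fps_X * (E * (x * H + (1 - x)) + C * (H - E))"
  proof (rule fps_ext)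
    fix n
    show "fps_nth H n = fps_nth (E + fps_X * (E * (x * H + (1 - x)) + C * (H - E))) n"
    proof (cases n)
      case 0
      then show ?thesis by (simp add: H_def stack_series_def E_def)
    next
      case (Suc m)
      have "fps_nth (C * (H - E)) m = (\<Sum>r<Suc m. fps_nth C r * fps_nth (H - E) (m - r))"
        by (simp only: fps_mult_nth atLeast0AtMost lessThan_Suc_atMost)
      also have "\<dots> = (\<Sum>r<m. fps_nth C r * fps_nth (H - E) (m - r))"
        by (simp add: H_def stack_series_def E_def)
      also have "\<dots> = (\<Sum>r<m. fps_nth C r * stack_egf (m - r))"
        by (intro sum.cong refl) (simp add: H_def stack_series_def E_def)
      finally show ?thesis
        using stack_egf_Suc[of m] by (simp add: Suc H_def stack_series_def E_def x_def C_def)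
    qed
  qed
  have N: "N = 1 + fps_X * (C * N)"
  proof (rule fps_ext)
    fix n
    show "fps_nth N n = fps_nth (1 + fps_X * (C * N)) n"
    proof (cases n)
      case 0
      then show ?thesis by (simp add: N_def stack_poly_0_0)
    next
      case (Suc m)
      have const_sum: "fps_const (sum f A) = (\<Sum>r\<in>A. fps_const (f r))"
        for f :: "nat \<Rightarrow> rat poly" and A
        by (rule fps_ext) (simp add: fps_sum_nth)
      have "fps_nth N n = (\<Sum>r\<le>m. fps_nth C r * fps_nth N (m - r))"
        by (simp add: Suc N_def C_def stack_poly_0_right_Suc const_sum)
      then show ?thesis
        by (simp add: Suc fps_mult_nth[of C] atLeast0AtMost)
    qed
  qed
  have Z: "Z = fps_X + (1 - x) * fps_X * Z + x * Z ^ 2"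
    using N C unfolding Z_def by algebra
  \<comment> \<open>By \<open>stack_poly_1\<close> the derivative of the Eulerian series is
    \<open>stack_egf 1\<close>, which \<open>stack_egf_Suc\<close> computes from
    \<open>stack_egf 0\<close>.\<close>
  have E': "fps_coeff_deriv E = E * (x * E + (1 - x))"
  proof -
    have "fps_deriv (stack_egf 0) = stack_egf 1"
      unfolding fps_deriv_stack_egf by (simp only: stack_egf_def flip: stack_poly_1)
    then have "fps_deriv (stack_egf 0) = stack_egf 0 *
        (fps_const (monom 1 1) * stack_egf 0 + (1 - fps_const (monom 1 1)))"
      using stack_egf_Suc[of 0] by simp
    then have "fps_const (fps_deriv (stack_egf 0)) = E * (x * E + (1 - x))"
      by (simp add: E_def x_def flip: fps_const_mult fps_const_add fps_const_sub)
    moreover have "fps_coeff_deriv E = fps_const (fps_deriv (stack_egf 0))"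
      by (rule fps_ext) (simp add: fps_coeff_deriv_def E_def)
    ultimately show ?thesis by simp
  qed
  have x': "fps_coeff_deriv x = 0" "fps_coeff_deriv 1 = (0 :: rat poly fps fps)"
    and Z': "fps_coeff_deriv Z = 0"
    by (auto intro!: fps_ext simp: fps_coeff_deriv_def x_def Z_def N_def)
  \<comment> \<open>Multiplying \<open>H\<close> by \<open>N\<close> and replacing
    \<open>fps_X * C * N\<close> by \<open>N - 1\<close> eliminates \<open>C\<close> and leaves a
    linear equation for \<open>H\<close>.\<close>
  have HE: "H * (1 - x * E * Z) = E * (1 + (1 - x) * Z)"
    using H N C unfolding Z_def by algebra
  have S: "S * (1 - (1 - x) * fps_X - 2 * x * Z) = 1"
    unfolding S_def x_def
  proof (rule fps_inverse_sqrt_by_recurrence)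
    let ?x = "fps_const (monom 1 1 :: rat poly)"
    have x1: "[:1, 1:] = 1 + monom (1 :: rat) 1" "[:1, -1:] = 1 - monom (1 :: rat) 1"
      by (simp_all add: monom_altdef one_pCons)
    show "fps_const (narayana_B_poly (Suc 0)) = 1"
      by (simp add: narayana_B_poly_def)
    have "narayana_B_poly (Suc 1) = [:1, 1:]"
      by (simp add: narayana_B_poly_def numeral_2_eq_2 monom_altdef one_pCons)
    then show "fps_const (narayana_B_poly (Suc 1)) = 1 + ?x"
      by (simp add: x1 flip: fps_const_add)
    show "of_nat (m + 2) * fps_const (narayana_B_poly (Suc (m + 2))) =
      of_nat (2 * m + 3) * (1 + ?x) * fps_const (narayana_B_poly (Suc (m + 1)))
      - of_nat (m + 1) * (1 - ?x) ^ 2 * fps_const (narayana_B_poly (Suc m))" for m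
    proof -
      have one: "1 + ?x = fps_const (1 + monom 1 1)" "1 - ?x = fps_const (1 - monom 1 1)"
        by (simp_all flip: fps_const_add fps_const_sub)
      have "of_nat (m + 2) * narayana_B_poly (Suc (m + 2)) =
        of_nat (2 * m + 3) * (1 + monom 1 1) * narayana_B_poly (Suc (m + 1))
        - of_nat (m + 1) * (1 - monom 1 1) ^ 2 * narayana_B_poly (Suc m)"
        using narayana_B_poly_recurrence[of m] by (simp only: x1) (simp add: numeral_3_eq_3)
      then show ?thesis
        unfolding one power2_eq_square fps_of_nat[symmetric] fps_const_mult fps_const_sub
        by (simp only:)
    qed
    show "fps_nth Z 0 = 0"
      by (simp add: Z_def)
    show "Z = fps_X + (1 - fps_const ?x) * fps_X * Z + fps_const ?x * Z ^ 2"
      using Z by (simp only: x_def)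
  qed
  \<comment> \<open>Differentiating the quadratic equation puts the factor inverted by
    \<open>S\<close> in front of the derivative of \<open>Z\<close>.\<close>
  have dZ: "fps_deriv Z = S * (1 + (1 - x) * Z)"
  proof -
    have "fps_deriv Z = fps_deriv (fps_X + (1 - x) * fps_X * Z + x * Z ^ 2)"
      using Z by (rule arg_cong)
    also have "\<dots> = 1 + (1 - x) * Z + (1 - x) * fps_X * fps_deriv Z + 2 * x * Z * fps_deriv Z"
      by (simp add: x_def power2_eq_square algebra_simps)
    finally show ?thesis
      using S by algebra
  qed
  have dy: "fps_deriv H * (1 - x * E * Z) - H * (x * E * fps_deriv Z) = E * (1 - x) * fps_deriv Z"
  proof -
    have deriv_const: "fps_deriv x = 0" "fps_deriv E = 0" "fps_deriv 1 = (0 :: rat poly fps fps)"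
      by (simp_all add: x_def E_def)
    show ?thesis
      using arg_cong[OF HE, of fps_deriv]
      unfolding fps_deriv_mult fps_deriv_add fps_deriv_sub deriv_const by algebra
  qed
  have dt: "fps_coeff_deriv H * (1 - x * E * Z) - H * (x * fps_coeff_deriv E * Z) =
      fps_coeff_deriv E * (1 + (1 - x) * Z)"
    using arg_cong[OF HE, of fps_coeff_deriv]
    by (simp add: fps_coeff_deriv_mult fps_coeff_deriv_add fps_coeff_deriv_diff x' Z' algebra_simps)
  \<comment> \<open>Both derivatives of \<open>H\<close> are known up to the denominator in
    \<open>HE\<close>. Substituting \<open>dZ\<close> and \<open>E'\<close> gives them the common
    factor \<open>1 + (1 - x) * Z\<close>, and \<open>HE\<close> makes the rest agree.\<close>
  have "(fps_deriv H - S * fps_coeff_deriv H) * (1 - x * E * Z) = 0"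
    using dy dt dZ E' HE by algebra
  \<comment> \<open>\<open>Z\<close> has no constant term, so the denominator is nonzero and can be
    cancelled.\<close>
  moreover have "fps_nth (1 - x * E * Z) 0 = 1"
    by (simp add: Z_def)
  then have "1 - x * E * Z \<noteq> 0"
    by force
  ultimately have pde: "fps_deriv H = S * fps_coeff_deriv H"
    by simp
  show ?thesis
  proof (cases n)
    case (Suc m)
    \<comment> \<open>The coefficient of y^m in the differential equation; the derivative in t then
      raises \<open>k\<close> by one.\<close>
    have "of_nat (Suc m) * stack_egf (Suc m) =
        (\<Sum>i<Suc m. fps_const (narayana_B_poly (Suc i)) * fps_deriv (stack_egf (m - i)))"
      using arg_cong[OF pde, of "\<lambda>f. fps_nth f m"]
      by (simp add: fps_mult_nth H_def S_def stack_series_def fps_coeff_deriv_def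
          atLeast0AtMost lessThan_Suc_atMost del: of_nat_Suc sum.lessThan_Suc)
    then have "fps_nth (of_nat (Suc m) * stack_egf (Suc m)) k = fps_nth
        (\<Sum>i<Suc m. fps_const (narayana_B_poly (Suc i)) * fps_deriv (stack_egf (m - i))) k"
      by (rule arg_cong)
    then have "smult (1 / fact k) (of_nat n * stack_poly n k) = smult (1 / fact k)
        (\<Sum>i<n. narayana_B_poly (Suc i) * stack_poly (n - Suc i) (Suc k))"
      unfolding fps_sum_nth fps_of_nat[symmetric] fps_mult_left_const_nth fps_deriv_stack_egf
        smult_sum_right by (simp add: Suc stack_egf_def del: of_nat_Suc sum.lessThan_Suc)
    then have "smult (fact k) (smult (1 / fact k) (of_nat n * stack_poly n k)) =
        smult (fact k) (smult (1 / fact k)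
          (\<Sum>i<n. narayana_B_poly (Suc i) * stack_poly (n - Suc i) (Suc k)))"
      by (rule arg_cong)
    then show ?thesis
      by simp
  qed simp
qed

theorem corollary5p4:
  fixes n k :: nat
  assumes "n \<ge> 1" and "k \<ge> 1"
  shows "N_poly n k =
    smult (1 / fact n)
      (\<Sum>w\<in>sym_grp n. narayana_B_perm n w * eulerian_poly (num_cycles n w + k))"
proof -
  \<comment> \<open>Both sides obey the same recurrence in \<open>n\<close>, with Eulerian
    polynomials as initial values at n = 0.\<close>
  have "cycle_sum narayana_B_poly eulerian_poly k {1..n} = fact n * stack_poly n k"
    using cycle_sum_eq_fact_mult[of stack_poly eulerian_poly narayana_B_poly "{1..n}" k]
      stack_poly_recurrence by (simp add: eulerian_poly_eq_stack_poly)
  also have "\<dots> = smult (fact n) (stack_poly n k)"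
  proof -
    have "fact n = [:fact n :: rat:]"
      by (metis of_nat_fact of_nat_poly)
    then show ?thesis
      by simp
  qed
  finally show ?thesis
    unfolding sum_narayana_B_perm N_poly_eq_stack_poly by simp
qed

end
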